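(* Let $\alpha,\beta,r,\sigma,\kappa,\lambda,\mathcal A$ be real constants with $\alpha\neq 0$, $\sigma\neq 0$, $\mathcal A\ne 0$, $\sigma^2\neq 2r$, and let $f(\zeta)=\alpha(\zeta-\beta)^2$. Then the function $$u(x,t)=\beta-\frac{24\sigma^2}{\alpha\left(2\lambda\sigma+\sqrt2(\sigma^2-2r)t+2\sqrt2\log|x|\right)^2}$$ is a solution, at all points $(x,t)$ with $x\neq0$ at which the denominator does not vanish, of the equation $$u_t+\tfrac12\sigma^2x^2u_{xx}+r x u_x+f(u)=0,$$ and it satisfies the barrier condition $u(H(t),t)=R(t)$ for all $t>-\kappa$, where $$H(t)=e^{-\frac{\sigma}{\sqrt2}\lambda+\left(r-\frac12\sigma^2\right)\left(t+\mathcal A\sqrt{\kappa+t}\right)},\qquad R(t)=\beta-\frac{12\sigma^2}{\mathcal A^2\alpha(t+\kappa)(\sigma^2-2r)^2}.$$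
   Context: $u=u(x,t)$ is a real-valued function; subscripts denote partial derivatives; $\log$ is the natural logarithm. $H$ is the barrier function and $R$ the rebate function of a (down-and-out) barrier option, and the barrier condition is $u(H(t),t)=R(t)$. *)

theory Defs
  imports "HOL-Analysis.Analysis"
begin

text \<open>
  Functions of \<open>(x, t)\<close> are curried, with the space variable first.
  The constant \<^const>\<open>deriv\<close> is total and has an unspecified value where no derivative exists, so
  the existence of \<open>u_t\<close>, \<open>u_x\<close> and \<open>u_xx\<close> is part of being a solution at a point; \<open>u_x\<close> has to
  exist near \<open>x\<close> for \<open>u_xx\<close> to make sense.
\<close>

definition bs_solution_at ::
  "real \<Rightarrow> real \<Rightarrow> (real \<Rightarrow> real) \<Rightarrow> (real \<Rightarrow> real \<Rightarrow> real) \<Rightarrow> real \<Rightarrow> real \<Rightarrow> bool" where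
  "bs_solution_at r \<sigma> f u x t \<longleftrightarrow>
     (\<lambda>s. u x s) differentiable at t \<and>
     (\<forall>\<^sub>F y in nhds x. (\<lambda>z. u z t) differentiable at y) \<and>
     deriv (\<lambda>z. u z t) differentiable at x \<and>
     deriv (\<lambda>s. u x s) t
       + 1 / 2 * \<sigma>\<^sup>2 * x\<^sup>2 * deriv (deriv (\<lambda>z. u z t)) x
       + r * x * deriv (\<lambda>z. u z t) x
       + f (u x t) = 0"

end

theory Submission imports Defs
begin

text \<open>
  In the coordinate \<open>y = ln \<bar>x\<bar>\<close> the operator \<open>\<partial>\<^sub>t + (\<sigma>\<^sup>2/2) x\<^sup>2 \<partial>\<^sub>x\<^sup>2 + r x \<partial>\<^sub>x\<close> has constant
  coefficients: it is \<open>\<partial>\<^sub>t + (\<sigma>\<^sup>2/2) \<partial>\<^sub>y\<^sup>2 + (r - \<sigma>\<^sup>2/2) \<partial>\<^sub>y\<close>.  So one may look for travelling waves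
  \<open>u = \<beta> + w(L)\<close> with a phase \<open>L = c + b t + d y\<close>.  If \<open>b = (\<sigma>\<^sup>2/2 - r) d\<close>, the transport terms cancel
  and what remains is the ordinary differential equation \<open>(\<sigma>\<^sup>2 d\<^sup>2/2) w'' + \<alpha> w\<^sup>2 = 0\<close>.  It has the
  solution \<open>w = - K / L\<^sup>2\<close>, since both terms are then multiples of \<open>1 / L\<^sup>4\<close>, and they balance
  when \<open>\<alpha> K = 3 \<sigma>\<^sup>2 d\<^sup>2\<close>.  This is lemma \<open>inverse_square_wave_solution\<close>; the theorem is the case
  \<open>d = 2 \<surd>2\<close>.

  The barrier is the curve on which the phase equals \<open>- \<surd>2 (\<sigma>\<^sup>2 - 2 r) A \<surd>(t + \<kappa>)\<close>: the logarithm of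
  \<open>H t\<close> is made to cancel the constant and the linear part of \<open>L\<close>.  Squaring then gives the rebate.
\<close>

lemma DERIV_ln_abs:
  fixes x :: real
  assumes "x \<noteq> 0"
  shows "((\<lambda>z. ln \<bar>z\<bar>) has_real_derivative 1 / x) (at x)"
proof -
  \<comment> \<open>The square removes the absolute value, so the two signs of \<open>x\<close> need no separate treatment.\<close>
  have eq: "(\<lambda>z::real. ln \<bar>z\<bar>) = (\<lambda>z. ln (z\<^sup>2) / 2)"
  proof
    fix z :: real
    show "ln \<bar>z\<bar> = ln (z\<^sup>2) / 2"
    proof (cases "z = 0")
      case False
      then have "ln (\<bar>z\<bar> ^ 2) = 2 * ln \<bar>z\<bar>"
        by (subst ln_realpow) auto
      then show ?thesis by simp
    qed simp
  qed
  have "((\<lambda>z. ln (z\<^sup>2) / 2) has_real_derivative 2 * x / x\<^sup>2 / 2) (at x)"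
    using assms by (auto intro!: derivative_eq_intros)
  then show ?thesis
    unfolding eq using assms by (simp add: power2_eq_square)
qed

text \<open>
  The two hypotheses on \<open>b\<close> and \<open>K\<close> make the coefficients of \<open>1 / L\<^sup>3\<close> and of \<open>1 / L\<^sup>4\<close> vanish, where
  \<open>L\<close> is the phase.
\<close>

lemma inverse_square_wave_solution:
  fixes \<alpha> \<beta> r \<sigma> b c d K x t :: real
  assumes b: "b = (\<sigma>\<^sup>2 / 2 - r) * d"
    and K: "\<alpha> * K = 3 * \<sigma>\<^sup>2 * d\<^sup>2"
    and x: "x \<noteq> 0"
    and nz: "c + b * t + d * ln \<bar>x\<bar> \<noteq> 0"
  shows "bs_solution_at r \<sigma> (\<lambda>\<zeta>. \<alpha> * (\<zeta> - \<beta>)\<^sup>2)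
           (\<lambda>x t. \<beta> - K / (c + b * t + d * ln \<bar>x\<bar>)\<^sup>2) x t"
proof -
  define L where "L z s = c + b * s + d * ln \<bar>z\<bar>" for z s :: real
  define v where "v z s = \<beta> - K / (L z s)\<^sup>2" for z s :: real
  define v\<^sub>x where "v\<^sub>x z = 2 * K * d / (z * L z t ^ 3)" for z :: real
  have Lx: "((\<lambda>z. L z t) has_real_derivative d / y) (at y)" if "y \<noteq> 0" for y
    unfolding L_def using DERIV_add[OF DERIV_const DERIV_cmult[OF DERIV_ln_abs[OF that]]]
    by simp
  have nzL: "L x t \<noteq> 0" using nz by (simp add: L_def)

  have vt: "((\<lambda>s. v x s) has_real_derivative 2 * K * b / L x t ^ 3) (at t)"
  proof -
    have "((\<lambda>s. L x s) has_real_derivative b) (at t)"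
      unfolding L_def by (auto intro!: derivative_eq_intros)
    then show ?thesis
      unfolding v_def using nzL
      by (auto intro!: derivative_eq_intros simp: field_simps eval_nat_numeral)
  qed
  have vx: "((\<lambda>z. v z t) has_real_derivative v\<^sub>x y) (at y)"
    if "y \<noteq> 0" "L y t \<noteq> 0" for y
    unfolding v_def v\<^sub>x_def using that Lx[OF that(1)]
    by (auto intro!: derivative_eq_intros simp: field_simps eval_nat_numeral)
  have near: "\<forall>\<^sub>F y in nhds x. y \<noteq> 0 \<and> L y t \<noteq> 0"
  proof (rule eventually_conj)
    show "\<forall>\<^sub>F y in nhds x. y \<noteq> 0"
      using x by (rule t1_space_nhds)
    have "((\<lambda>z. L z t) \<longlongrightarrow> L x t) (nhds x)"
      using DERIV_isCont[OF Lx[OF x]]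
      by (simp add: isCont_def tendsto_nhds_iff)
    then show "\<forall>\<^sub>F y in nhds x. L y t \<noteq> 0"
      using nzL by (rule tendsto_imp_eventually_ne)
  qed
  have deriv_near: "\<forall>\<^sub>F y in nhds x. v\<^sub>x y = deriv (\<lambda>z. v z t) y"
    using near by eventually_elim (simp add: DERIV_imp_deriv[OF vx])
  define v\<^sub>x\<^sub>x where "v\<^sub>x\<^sub>x = - 2 * K * d / (x\<^sup>2 * L x t ^ 3) - 6 * K * d\<^sup>2 / (x\<^sup>2 * L x t ^ 4)"
  have "(v\<^sub>x has_real_derivative v\<^sub>x\<^sub>x) (at x)"
    unfolding v\<^sub>x_def[abs_def] v\<^sub>x\<^sub>x_def using x nzL Lx[OF x]
    by (auto intro!: derivative_eq_intros simp: field_simps eval_nat_numeral)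
  then have vxx: "(deriv (\<lambda>z. v z t) has_real_derivative v\<^sub>x\<^sub>x) (at x)"
    using DERIV_cong_ev[OF refl deriv_near refl] by simp

  have "\<alpha> * K * K = 3 * \<sigma>\<^sup>2 * d\<^sup>2 * K" using K by simp
  then have "\<alpha> * (v x t - \<beta>)\<^sup>2 = 3 * \<sigma>\<^sup>2 * d\<^sup>2 * K / L x t ^ 4"
    by (simp add: v_def power_divide power2_eq_square eval_nat_numeral mult.assoc)
  moreover have "1 / 2 * \<sigma>\<^sup>2 * x\<^sup>2 * v\<^sub>x\<^sub>x
      = - \<sigma>\<^sup>2 * K * d / L x t ^ 3 - 3 * \<sigma>\<^sup>2 * d\<^sup>2 * K / L x t ^ 4"
    unfolding v\<^sub>x\<^sub>x_def using x nzL by (simp add: field_simps)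
  moreover have "r * x * v\<^sub>x x = 2 * r * K * d / L x t ^ 3"
    unfolding v\<^sub>x_def using x by simp
  moreover have "2 * K * b / L x t ^ 3 = \<sigma>\<^sup>2 * K * d / L x t ^ 3 - 2 * r * K * d / L x t ^ 3"
    unfolding b diff_divide_distrib[symmetric] by (simp add: algebra_simps)
  ultimately have pde:
    "2 * K * b / L x t ^ 3 + 1 / 2 * \<sigma>\<^sup>2 * x\<^sup>2 * v\<^sub>x\<^sub>x + r * x * v\<^sub>x x + \<alpha> * (v x t - \<beta>)\<^sup>2 = 0"
    by linarith

  have "bs_solution_at r \<sigma> (\<lambda>\<zeta>. \<alpha> * (\<zeta> - \<beta>)\<^sup>2) v x t"
    unfolding bs_solution_at_def
  proof (intro conjI)
    show "(\<lambda>s. v x s) differentiable at t"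
      using vt real_differentiable_def by blast
    show "\<forall>\<^sub>F y in nhds x. (\<lambda>z. v z t) differentiable at y"
      using near by eventually_elim (use vx real_differentiable_def in blast)
    show "deriv (\<lambda>z. v z t) differentiable at x"
      using vxx real_differentiable_def by blast
    show "deriv (\<lambda>s. v x s) t + 1 / 2 * \<sigma>\<^sup>2 * x\<^sup>2 * deriv (deriv (\<lambda>z. v z t)) x
        + r * x * deriv (\<lambda>z. v z t) x + \<alpha> * (v x t - \<beta>)\<^sup>2 = 0"
      unfolding DERIV_imp_deriv[OF vt] DERIV_imp_deriv[OF vxx] DERIV_imp_deriv[OF vx[OF x nzL]]
      by (rule pde)
  qed
  then show ?thesis
    unfolding v_def[abs_def] L_def .
qed

theorem mainTheorem1:
  fixes \<alpha> \<beta> r \<sigma> \<kappa> l A :: real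
    and f H R :: "real \<Rightarrow> real"
    and D u :: "real \<Rightarrow> real \<Rightarrow> real"
  assumes "\<alpha> \<noteq> 0" and "\<sigma> \<noteq> 0" and "A \<noteq> 0" and "\<sigma>\<^sup>2 \<noteq> 2 * r"
    and f: "\<And>\<zeta>. f \<zeta> = \<alpha> * (\<zeta> - \<beta>)\<^sup>2"
    and D: "\<And>x t. D x t =
      \<alpha> * (2 * l * \<sigma> + sqrt 2 * (\<sigma>\<^sup>2 - 2 * r) * t + 2 * sqrt 2 * ln \<bar>x\<bar>)\<^sup>2"
    and u: "\<And>x t. u x t = \<beta> - 24 * \<sigma>\<^sup>2 / D x t"
    and H: "\<And>t. H t =
      exp (- (\<sigma> / sqrt 2) * l + (r - 1 / 2 * \<sigma>\<^sup>2) * (t + A * sqrt (\<kappa> + t)))"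
    and R: "\<And>t. R t = \<beta> - 12 * \<sigma>\<^sup>2 / (A\<^sup>2 * \<alpha> * (t + \<kappa>) * (\<sigma>\<^sup>2 - 2 * r)\<^sup>2)"
  shows "(\<forall>x t. x \<noteq> 0 \<and> D x t \<noteq> 0 \<longrightarrow> bs_solution_at r \<sigma> f u x t) \<and>
         (\<forall>t > - \<kappa>. u (H t) t = R t)"
proof (intro conjI allI impI)
  fix x t :: real
  assume "x \<noteq> 0 \<and> D x t \<noteq> 0"
  then have x: "x \<noteq> 0"
    and nz: "2 * l * \<sigma> + sqrt 2 * (\<sigma>\<^sup>2 - 2 * r) * t + 2 * sqrt 2 * ln \<bar>x\<bar> \<noteq> 0"
    by (auto simp: D)
  have "bs_solution_at r \<sigma> (\<lambda>\<zeta>. \<alpha> * (\<zeta> - \<beta>)\<^sup>2)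
     (\<lambda>x t. \<beta> - 24 * \<sigma>\<^sup>2 / \<alpha> /
        (2 * l * \<sigma> + sqrt 2 * (\<sigma>\<^sup>2 - 2 * r) * t + 2 * sqrt 2 * ln \<bar>x\<bar>)\<^sup>2) x t"
    by (rule inverse_square_wave_solution[OF _ _ x nz])
      (use \<open>\<alpha> \<noteq> 0\<close> in \<open>auto simp: algebra_simps power_mult_distrib\<close>)
  moreover have "u = (\<lambda>x t. \<beta> - 24 * \<sigma>\<^sup>2 / \<alpha> /
        (2 * l * \<sigma> + sqrt 2 * (\<sigma>\<^sup>2 - 2 * r) * t + 2 * sqrt 2 * ln \<bar>x\<bar>)\<^sup>2)"
    by (intro ext) (simp add: u D)
  moreover have "f = (\<lambda>\<zeta>. \<alpha> * (\<zeta> - \<beta>)\<^sup>2)"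
    by (rule ext) (rule f)
  ultimately show "bs_solution_at r \<sigma> f u x t" by simp
next
  fix t :: real
  assume t: "- \<kappa> < t"
  let ?s = "sqrt (\<kappa> + t)"
  have lnH: "ln \<bar>H t\<bar> = - (\<sigma> / sqrt 2) * l + (r - 1 / 2 * \<sigma>\<^sup>2) * (t + A * ?s)"
    by (simp add: H)
  have cancel: "2 * sqrt 2 * (\<sigma> / sqrt 2) = 2 * \<sigma>" by simp
  have "2 * sqrt 2 * ln \<bar>H t\<bar>
      = - (2 * sqrt 2 * (\<sigma> / sqrt 2)) * l - sqrt 2 * (\<sigma>\<^sup>2 - 2 * r) * (t + A * ?s)"
    unfolding lnH by algebra
  then have phase: "2 * l * \<sigma> + sqrt 2 * (\<sigma>\<^sup>2 - 2 * r) * t + 2 * sqrt 2 * ln \<bar>H t\<bar>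
      = - (sqrt 2 * (\<sigma>\<^sup>2 - 2 * r) * A * ?s)"
    unfolding cancel by algebra
  have "D (H t) t = 2 * (A\<^sup>2 * \<alpha> * (t + \<kappa>) * (\<sigma>\<^sup>2 - 2 * r)\<^sup>2)"
    unfolding D phase using t by (simp add: power_mult_distrib)
  then show "u (H t) t = R t" by (simp add: u R)
qed

end
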